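(* Let $X$ be a Hausdorff space and let $J$ be a norm-closed ideal in $C_b(X)$. Suppose that every net $(f_\alpha)$ in $J$ that is un-null in $J$ is also un-null in $C_b(X)$. Then $J$ is a projection band in $C_b(X)$.
   Context: $C_b(X)$ is the Banach lattice of bounded continuous real-valued functions on $X$ with the supremum norm and pointwise order. Ideal means order ideal: a linear subspace $Y$ of a vector lattice $E$ such that $0\le |x|\le |y|$ with $x\in E$, $y\in Y$ implies $x\in Y$ (for norm-closed subspaces of $C_b(X)$ order ideals and algebra ideals are the same). In a Banach lattice $E$, a net $(x_\alpha)$ un-converges to $x\in E$ if for every $y\in E_+$ one has $\bigl\||x_\alpha-x|\wedge y\bigr\|\to 0$; the net is un-null in $E$ if it un-converges to $0$ in $E$. A closed ideal $J$ is regarded as a Banach lattice itself, so a net $(f_\alpha)$ in $J$ is un-null in $J$ if $\bigl\||f_\alpha|\wedge g\bigr\|\to 0$ for every $g\in J_+$. A band $B$ in a vector lattice $E$ is an order ideal such that whenever $(x_\alpha)$ is a net in $B$ with $0\le x_\alpha\nearrow x$ in $E$ (increasing with supremum $x$ in $E$), then $x\in B$. With $B^d=\{x\in E: |x|\wedge |b|=0\text{ for all } b\in B\}$, a band $B$ is a projection band if $E=B\oplus B^d$. *)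

theory Defs
  imports
    "HOL-Analysis.Analysis"
    "HOL-Library.Lattice_Algebras"
    "HOL-Library.Lub_Glb"
begin

section \<open>Vector lattices and Banach lattices\<close>

class vector_lattice = ordered_real_vector + lattice_ab_group_add_abs

class banach_lattice = vector_lattice + banach +
  assumes norm_mono_abs: "\<bar>x\<bar> \<le> \<bar>y\<bar> \<Longrightarrow> norm x \<le> norm y"

instance real :: banach_lattice
  by standard (auto simp: sup_real_def)

lemma sup_diff_abs_le:
  fixes a b c d :: "'a::vector_lattice"
  shows "\<bar>sup a b - sup c d\<bar> \<le> \<bar>a - c\<bar> + \<bar>b - d\<bar>"
proof -
  have *: "sup a b - sup c d \<le> \<bar>a - c\<bar> + \<bar>b - d\<bar>" for a b c d :: 'a
  proof -
    have "a \<le> c + \<bar>a - c\<bar>" "b \<le> d + \<bar>b - d\<bar>"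
      using abs_ge_self[of "a - c"] abs_ge_self[of "b - d"] by (simp_all add: algebra_simps)
    moreover have "c + \<bar>a - c\<bar> \<le> sup c d + (\<bar>a - c\<bar> + \<bar>b - d\<bar>)"
      by (intro add_mono) auto
    moreover have "d + \<bar>b - d\<bar> \<le> sup c d + (\<bar>a - c\<bar> + \<bar>b - d\<bar>)"
      by (intro add_mono) auto
    ultimately have "sup a b \<le> sup c d + (\<bar>a - c\<bar> + \<bar>b - d\<bar>)"
      by (meson le_sup_iff order_trans)
    then show ?thesis by (simp only: diff_le_eq add.commute)
  qed
  show ?thesis
  proof (rule abs_leI)
    show "- (sup a b - sup c d) \<le> \<bar>a - c\<bar> + \<bar>b - d\<bar>"
      using *[of c d a b] by (simp only: minus_diff_eq abs_minus_commute)
  qed (rule *)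
qed

lemma norm_abs_banach_lattice [simp]: "norm \<bar>x\<bar> = norm x" for x :: "'a::banach_lattice"
  by (intro antisym norm_mono_abs) simp_all

lemma norm_sup_diff_le:
  fixes a b c d :: "'a::banach_lattice"
  shows "norm (sup a b - sup c d) \<le> norm (a - c) + norm (b - d)"
proof -
  have "norm (sup a b - sup c d) \<le> norm (\<bar>a - c\<bar> + \<bar>b - d\<bar>)"
    using sup_diff_abs_le[of a b c d] by (intro norm_mono_abs) (simp add: abs_of_nonneg)
  also have "\<dots> \<le> norm \<bar>a - c\<bar> + norm \<bar>b - d\<bar>" by (rule norm_triangle_ineq)
  finally show ?thesis by simp
qed

lemma tendsto_sup_banach_lattice:
  fixes f g :: "'i \<Rightarrow> 'a::banach_lattice"
  assumes "(f \<longlongrightarrow> a) F" "(g \<longlongrightarrow> b) F"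
  shows "((\<lambda>x. sup (f x) (g x)) \<longlongrightarrow> sup a b) F"
proof -
  have "((\<lambda>x. norm (f x - a) + norm (g x - b)) \<longlongrightarrow> 0) F"
    using tendsto_add[OF tendsto_norm_zero[OF assms(1)[THEN LIM_zero]]
        tendsto_norm_zero[OF assms(2)[THEN LIM_zero]]] by simp
  then have "((\<lambda>x. sup (f x) (g x) - sup a b) \<longlongrightarrow> 0) F"
    by (rule Lim_null_comparison[OF always_eventually, rotated]) (intro allI norm_sup_diff_le)
  then show ?thesis by (rule LIM_zero_cancel)
qed

lemma sup_cont:
  fixes f g :: "'a::topological_space \<Rightarrow> 'b::banach_lattice"
  assumes "f \<in> bcontfun" "g \<in> bcontfun"
  shows "(\<lambda>x. sup (f x) (g x)) \<in> bcontfun"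
proof -
  obtain A B where AB: "\<And>x. norm (f x) \<le> A" "\<And>x. norm (g x) \<le> B"
    using assms by (auto simp: bcontfun_def bounded_iff)
  show ?thesis
  proof (rule bcontfun_normI)
    show "continuous_on UNIV (\<lambda>x. sup (f x) (g x))"
      using assms by (auto simp: bcontfun_def continuous_on_def intro: tendsto_sup_banach_lattice)
    show "norm (sup (f x) (g x)) \<le> A + B" for x
      using norm_sup_diff_le[of "f x" "g x" 0 0] AB[of x] by simp
  qed
qed

lemma inf_cont:
  fixes f g :: "'a::topological_space \<Rightarrow> 'b::banach_lattice"
  assumes "f \<in> bcontfun" "g \<in> bcontfun"
  shows "(\<lambda>x. inf (f x) (g x)) \<in> bcontfun"
  using uminus_cont[OF sup_cont[OF uminus_cont[OF assms(1)] uminus_cont[OF assms(2)]]]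
  by (simp only: inf_eq_neg_sup)

lemma abs_cont:
  fixes f :: "'a::topological_space \<Rightarrow> 'b::banach_lattice"
  assumes "f \<in> bcontfun"
  shows "(\<lambda>x. \<bar>f x\<bar>) \<in> bcontfun"
  using sup_cont[OF assms uminus_cont[OF assms]] by (simp only: abs_lattice)


section \<open>The Banach lattice of bounded continuous functions\<close>

text \<open>The library provides completeness only for metric domains.\<close>

instance bcontfun :: (topological_space, complete_space) complete_space
proof
  fix f :: "nat \<Rightarrow> ('a, 'b) bcontfun"
  assume "Cauchy f"
  then obtain g where "uniform_limit UNIV f g sequentially"
    using uniformly_convergent_eq_cauchy[of "\<lambda>_. True" f]
    unfolding Cauchy_def uniform_limit_sequentially_iff
    by (metis dist_fun_lt_imp_dist_val_lt)
  from uniform_limit_bcontfunE[OF this sequentially_bot]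
  obtain l' where "g = apply_bcontfun l'" "(f \<longlonglongrightarrow> l')" by metis
  then show "convergent f"
    by (intro convergentI)
qed

instantiation bcontfun :: (topological_space, banach_lattice) banach_lattice
begin

definition less_eq_bcontfun :: "('a \<Rightarrow>\<^sub>C 'b) \<Rightarrow> ('a \<Rightarrow>\<^sub>C 'b) \<Rightarrow> bool"
  where "f \<le> g \<longleftrightarrow> (\<forall>x. apply_bcontfun f x \<le> apply_bcontfun g x)"

definition less_bcontfun :: "('a \<Rightarrow>\<^sub>C 'b) \<Rightarrow> ('a \<Rightarrow>\<^sub>C 'b) \<Rightarrow> bool"
  where "f < g \<longleftrightarrow> f \<le> g \<and> \<not> g \<le> f" for f g :: "'a \<Rightarrow>\<^sub>C 'b"

definition sup_bcontfun :: "('a \<Rightarrow>\<^sub>C 'b) \<Rightarrow> ('a \<Rightarrow>\<^sub>C 'b) \<Rightarrow> 'a \<Rightarrow>\<^sub>C 'b"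
  where "sup f g = Bcontfun (\<lambda>x. sup (apply_bcontfun f x) (apply_bcontfun g x))"

definition inf_bcontfun :: "('a \<Rightarrow>\<^sub>C 'b) \<Rightarrow> ('a \<Rightarrow>\<^sub>C 'b) \<Rightarrow> 'a \<Rightarrow>\<^sub>C 'b"
  where "inf f g = Bcontfun (\<lambda>x. inf (apply_bcontfun f x) (apply_bcontfun g x))"

definition abs_bcontfun :: "('a \<Rightarrow>\<^sub>C 'b) \<Rightarrow> 'a \<Rightarrow>\<^sub>C 'b"
  where "\<bar>f\<bar> = Bcontfun (\<lambda>x. \<bar>apply_bcontfun f x\<bar>)"

lemma apply_bcontfun_sup [simp]:
  "apply_bcontfun (sup f g) x = sup (apply_bcontfun f x) (apply_bcontfun g x)"
  for f g :: "'a \<Rightarrow>\<^sub>C 'b"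
  by (simp add: sup_bcontfun_def Bcontfun_inverse sup_cont apply_bcontfun)

lemma apply_bcontfun_inf [simp]:
  "apply_bcontfun (inf f g) x = inf (apply_bcontfun f x) (apply_bcontfun g x)"
  for f g :: "'a \<Rightarrow>\<^sub>C 'b"
  by (simp add: inf_bcontfun_def Bcontfun_inverse inf_cont apply_bcontfun)

lemma apply_bcontfun_abs [simp]: "apply_bcontfun \<bar>f\<bar> x = \<bar>apply_bcontfun f x\<bar>"
  for f :: "'a \<Rightarrow>\<^sub>C 'b"
  by (simp add: abs_bcontfun_def Bcontfun_inverse abs_cont apply_bcontfun)

instance
proof
  fix f g :: "'a \<Rightarrow>\<^sub>C 'b"
  assume "\<bar>f\<bar> \<le> \<bar>g\<bar>"
  then have "norm (f x) \<le> norm (g x)" for x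
    by (intro norm_mono_abs) (simp add: less_eq_bcontfun_def)
  then show "norm f \<le> norm g"
    by (intro norm_bound) (meson norm_bounded order_trans)
next
  fix f g h :: "'a \<Rightarrow>\<^sub>C 'b" and r s :: real
  show "f < g \<longleftrightarrow> f \<le> g \<and> \<not> g \<le> f" by (rule less_bcontfun_def)
  show "f \<le> f" by (simp add: less_eq_bcontfun_def)
  show "f \<le> g \<Longrightarrow> g \<le> h \<Longrightarrow> f \<le> h"
    unfolding less_eq_bcontfun_def by (blast intro: order_trans)
  show "f \<le> g \<Longrightarrow> g \<le> f \<Longrightarrow> f = g"
    unfolding less_eq_bcontfun_def by (intro bcontfun_eqI antisym) simp_all
  show "inf f g \<le> f" "inf f g \<le> g" "f \<le> sup f g" "g \<le> sup f g"
    by (simp_all add: less_eq_bcontfun_def)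
  show "f \<le> g \<Longrightarrow> f \<le> h \<Longrightarrow> f \<le> inf g h" "g \<le> f \<Longrightarrow> h \<le> f \<Longrightarrow> sup g h \<le> f"
    by (simp_all add: less_eq_bcontfun_def)
  show "f \<le> g \<Longrightarrow> h + f \<le> h + g" by (simp add: less_eq_bcontfun_def)
  show "f \<le> g \<Longrightarrow> 0 \<le> r \<Longrightarrow> r *\<^sub>R f \<le> r *\<^sub>R g"
    by (simp add: less_eq_bcontfun_def scaleR_left_mono)
  show "r \<le> s \<Longrightarrow> 0 \<le> f \<Longrightarrow> r *\<^sub>R f \<le> s *\<^sub>R f"
    by (simp add: less_eq_bcontfun_def scaleR_right_mono)
  show "\<bar>f\<bar> = sup f (- f)"
    by (rule bcontfun_eqI) (simp only: apply_bcontfun_abs apply_bcontfun_sup uminus_bcontfun.rep_eq abs_lattice)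
qed

end


section \<open>Nets and un-convergence\<close>

definition directed :: "'i set \<Rightarrow> ('i \<Rightarrow> 'i \<Rightarrow> bool) \<Rightarrow> bool"
  where "directed I le \<longleftrightarrow> I \<noteq> {} \<and> (\<forall>i\<in>I. le i i) \<and>
    (\<forall>i\<in>I. \<forall>j\<in>I. \<forall>k\<in>I. le i j \<longrightarrow> le j k \<longrightarrow> le i k) \<and>
    (\<forall>i\<in>I. \<forall>j\<in>I. \<exists>k\<in>I. le i k \<and> le j k)"

definition net_filter :: "'i set \<Rightarrow> ('i \<Rightarrow> 'i \<Rightarrow> bool) \<Rightarrow> 'i filter"
  where "net_filter I le = (INF i\<in>I. principal {j\<in>I. le i j})"

lemma eventually_net_filter:
  assumes "directed I le"
  shows "eventually P (net_filter I le) \<longleftrightarrow> (\<exists>i\<in>I. \<forall>j\<in>I. le i j \<longrightarrow> P j)"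
proof -
  have "eventually P (net_filter I le) \<longleftrightarrow>
      (\<exists>i\<in>I. eventually P (principal {j\<in>I. le i j}))"
    unfolding net_filter_def
  proof (rule eventually_INF_base)
    show "I \<noteq> {}" using assms by (simp add: directed_def)
    fix a b assume "a \<in> I" "b \<in> I"
    with assms obtain k where k: "k \<in> I" "le a k" "le b k" unfolding directed_def by blast
    have "le a j \<and> le b j" if "j \<in> I" "le k j" for j
      using assms k that \<open>a \<in> I\<close> \<open>b \<in> I\<close> unfolding directed_def by blast
    with k show "\<exists>x\<in>I. principal {j \<in> I. le x j}
        \<le> inf (principal {j \<in> I. le a j}) (principal {j \<in> I. le b j})"
      by (intro bexI[of _ k]) auto
  qed
  then show ?thesis by (auto simp: eventually_principal)
qed

text \<open>
  The set \<open>E\<close> is the Banach lattice in which the net is considered; it is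
  \<^term>\<open>UNIV\<close> or a closed ideal. The norm, modulus and infimum of the ambient space agree with
  those of the ideal.
\<close>

definition un_converges ::
    "'a::banach_lattice set \<Rightarrow> 'i set \<Rightarrow> ('i \<Rightarrow> 'i \<Rightarrow> bool) \<Rightarrow> ('i \<Rightarrow> 'a) \<Rightarrow> 'a \<Rightarrow> bool"
  where "un_converges E I le x l \<longleftrightarrow>
    (\<forall>y\<in>E. 0 \<le> y \<longrightarrow> ((\<lambda>i. norm (inf \<bar>x i - l\<bar> y)) \<longlongrightarrow> 0) (net_filter I le))"

definition un_null ::
    "'a::banach_lattice set \<Rightarrow> 'i set \<Rightarrow> ('i \<Rightarrow> 'i \<Rightarrow> bool) \<Rightarrow> ('i \<Rightarrow> 'a) \<Rightarrow> bool"
  where "un_null E I le x \<longleftrightarrow> un_converges E I le x 0"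

text \<open>
  Index sets of nets in \<open>'a\<close> are subsets of the following type. HOL cannot quantify over
  all index types inside a formula; this type is large enough for the purpose, since it holds the
  canonical net (pairs of a point and a filter set containing it) of every filter on \<open>'a\<close>.
  The lemmas \<open>un_null_all_nets\<close> and \<open>band_all_nets\<close> below show that the
  conditions quantified over such nets carry over to nets with an arbitrary index type.
\<close>

type_synonym 'a net_index = "'a \<times> 'a set"

lemma un_null_all_nets:
  fixes J E :: "'a::banach_lattice set" and I :: "'i set"
  assumes hyp: "\<And>(I :: 'a net_index set) le f.
      directed I le \<Longrightarrow> f ` I \<subseteq> J \<Longrightarrow> un_null J I le f \<Longrightarrow> un_null E I le f"
    and net: "directed I le" "f ` I \<subseteq> J" "un_null J I le f"
  shows "un_null E I le f"
proof -
  define F where "F = filtermap f (net_filter I le)"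
  define K where "K = {(x, A). x \<in> A \<and> A \<subseteq> J \<and> eventually (\<lambda>z. z \<in> A) F}"
  define le' :: "'a net_index \<Rightarrow> 'a net_index \<Rightarrow> bool" where "le' = (\<lambda>p q. snd q \<subseteq> snd p)"
  have J: "eventually (\<lambda>z. z \<in> J) F"
    using net(1,2) unfolding F_def eventually_filtermap eventually_net_filter[OF net(1)]
    unfolding directed_def by blast
  have inh: "\<exists>x. P x" if "eventually P F" for P
    using that net(1) unfolding F_def eventually_filtermap eventually_net_filter[OF net(1)]
    unfolding directed_def by blast
  have dir: "directed K le'"
    unfolding directed_def
  proof (intro conjI ballI impI)
    show "K \<noteq> {}" using J inh[OF J] by (auto simp: K_def)
  next
    fix p q assume "p \<in> K" "q \<in> K"
    then have ev: "eventually (\<lambda>z. z \<in> snd p \<inter> snd q) F" and sub: "snd p \<inter> snd q \<subseteq> J"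
      by (auto simp: K_def intro: eventually_conj)
    from inh[OF ev] obtain x where "x \<in> snd p \<inter> snd q" by blast
    with ev sub have "(x, snd p \<inter> snd q) \<in> K" by (simp add: K_def)
    then show "\<exists>k\<in>K. le' p k \<and> le' q k" by (rule bexI[rotated]) (simp add: le'_def)
  qed (auto simp: le'_def)
  have filt: "filtermap fst (net_filter K le') = F"
  proof (rule filter_eq_iff[THEN iffD2], intro allI iffI)
    fix P assume "eventually P (filtermap fst (net_filter K le'))"
    then obtain x A where xA: "(x, A) \<in> K" and *: "\<forall>q\<in>K. le' (x, A) q \<longrightarrow> P (fst q)"
      by (auto simp: eventually_filtermap eventually_net_filter[OF dir])
    have "P y" if "y \<in> A" for y
      using *[rule_format, of "(y, A)"] xA that by (auto simp: K_def le'_def)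
    moreover have "eventually (\<lambda>z. z \<in> A) F" using xA by (simp add: K_def)
    ultimately show "eventually P F" by (auto elim: eventually_mono)
  next
    fix P assume P: "eventually P F"
    have ev: "eventually (\<lambda>z. z \<in> {z \<in> J. P z}) F"
      using eventually_conj[OF J P] by simp
    from inh[OF ev] obtain x where "x \<in> {z \<in> J. P z}" by blast
    with ev have "(x, {z \<in> J. P z}) \<in> K" by (auto simp: K_def)
    then show "eventually P (filtermap fst (net_filter K le'))"
      unfolding eventually_filtermap eventually_net_filter[OF dir]
      by (intro bexI[of _ "(x, {z \<in> J. P z})"]) (auto simp: K_def le'_def)
  qed
  have "un_null S K le' fst \<longleftrightarrow> un_null S I le f" for S :: "'a set"
  proof -
    have "((\<lambda>i. h (fst i)) \<longlongrightarrow> 0) (net_filter K le') \<longleftrightarrow>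
        ((\<lambda>i. h (f i)) \<longlongrightarrow> 0) (net_filter I le)" for h :: "'a \<Rightarrow> real"
      using filterlim_filtermap[of h "nhds 0" fst "net_filter K le'"]
        filterlim_filtermap[of h "nhds 0" f "net_filter I le"] filt F_def
      by simp
    from this[of "\<lambda>z. norm (inf \<bar>z - 0\<bar> y)" for y] show ?thesis
      unfolding un_null_def un_converges_def by (simp only:)
  qed
  moreover have "fst ` K \<subseteq> J" by (auto simp: K_def)
  ultimately show ?thesis using hyp[OF dir] net(3) by blast
qed


section \<open>Ideals and projection bands\<close>

definition order_ideal :: "'a::vector_lattice set \<Rightarrow> bool"
  where "order_ideal Y \<longleftrightarrow> subspace Y \<and> (\<forall>x y. y \<in> Y \<longrightarrow> \<bar>x\<bar> \<le> \<bar>y\<bar> \<longrightarrow> x \<in> Y)"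

definition disjoint_complement :: "'a::vector_lattice set \<Rightarrow> 'a set"
  where "disjoint_complement B = {x. \<forall>b\<in>B. inf \<bar>x\<bar> \<bar>b\<bar> = 0}"

definition increasing_net ::
    "'i set \<Rightarrow> ('i \<Rightarrow> 'i \<Rightarrow> bool) \<Rightarrow> ('i \<Rightarrow> 'a::order) \<Rightarrow> bool"
  where "increasing_net I le x \<longleftrightarrow>
    directed I le \<and> (\<forall>i\<in>I. \<forall>j\<in>I. le i j \<longrightarrow> x i \<le> x j)"

definition band :: "'a::vector_lattice set \<Rightarrow> bool"
  where "band B \<longleftrightarrow> order_ideal B \<and>
    (\<forall>(I :: 'a net_index set) le x s.
      increasing_net I le x \<and> x ` I \<subseteq> B \<and> (\<forall>i\<in>I. 0 \<le> x i) \<and> isLub UNIV (x ` I) s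
      \<longrightarrow> s \<in> B)"

lemma band_all_nets:
  fixes B :: "'a::vector_lattice set" and I :: "'i set"
  assumes "band B" and inc: "increasing_net I le x"
    and x: "x ` I \<subseteq> B" "\<forall>i\<in>I. 0 \<le> x i" "isLub UNIV (x ` I) s"
  shows "s \<in> B"
proof -
  define K :: "'a net_index set" where "K = (\<lambda>i. (x i, {})) ` I"
  define le' :: "'a net_index \<Rightarrow> 'a net_index \<Rightarrow> bool" where "le' = (\<lambda>p q. fst p \<le> fst q)"
  have "increasing_net K le' fst"
    unfolding increasing_net_def directed_def
  proof (intro conjI ballI impI)
    show "K \<noteq> {}" using inc by (simp add: K_def increasing_net_def directed_def)
    fix p q assume "p \<in> K" "q \<in> K"
    then obtain i j where ij: "i \<in> I" "j \<in> I" "p = (x i, {})" "q = (x j, {})"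
      by (auto simp: K_def)
    with inc obtain k where k: "k \<in> I" "le i k" "le j k"
      unfolding increasing_net_def directed_def by blast
    with inc ij have "x i \<le> x k" "x j \<le> x k" by (simp_all add: increasing_net_def)
    with k ij show "\<exists>r\<in>K. le' p r \<and> le' q r"
      by (intro bexI[of _ "(x k, {})"]) (simp_all add: K_def le'_def)
  qed (auto simp: le'_def intro: order_trans)
  moreover have "fst ` K = x ` I" by (auto simp: K_def image_image)
  moreover have "\<forall>p\<in>K. 0 \<le> fst p" using x(2) by (auto simp: K_def)
  ultimately show ?thesis
    using \<open>band B\<close>[unfolded band_def, THEN conjunct2, THEN spec[of _ K], THEN spec[of _ le'],
        THEN spec[of _ fst], THEN spec[of _ s]] x by simp
qed

definition projection_band :: "'a::vector_lattice set \<Rightarrow> bool"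
  where "projection_band B \<longleftrightarrow> band B \<and> B \<inter> disjoint_complement B = {0} \<and>
    (\<forall>x. \<exists>b\<in>B. \<exists>d\<in>disjoint_complement B. x = b + d)"

end

(*
  Suppose that for all positive g in J and d > 0 there were a positive f in J with f \<and> g \<le> d
  that takes a value at least 1; indexed by (g, d) these f would form a net that is un-null in J
  but not in C_b(X). Hence some g in J and e > 0 satisfy: every positive f in J with f \<and> g \<le> e
  is below 1. Applied to all multiples, f = 0 whenever f vanishes outside {g \<le> e}.
  Testing this on (g \<and> (e - g))^+ shows that g omits the values in (0, e), and testing it on
  (h - cg)^+ shows that every h in J vanishes where g does. So J consists of all functions
  dominated by a multiple of g, that is, supported on the clopen set {g \<ge> e}.
*)
theory Submission
  imports Defs
begin

text \<open>Turns the hypothesis on nets into a condition on one test function \<open>g\<close> and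
  one tolerance \<open>e\<close>. If no such pair existed, the counterexamples chosen for all pairs
  would themselves form a net contradicting the hypothesis.\<close>

lemma un_null_transfer_witness:
  fixes J :: "('a::topological_space \<Rightarrow>\<^sub>C real) set"
  assumes J: "order_ideal J"
    and hyp: "\<And>(I :: ('a \<Rightarrow>\<^sub>C real) net_index set) le f.
      directed I le \<Longrightarrow> f ` I \<subseteq> J \<Longrightarrow> un_null J I le f \<Longrightarrow> un_null UNIV I le f"
  obtains (wit) g e where "g \<in> J" "0 \<le> g" "e > 0"
    "\<And>f x. f \<in> J \<Longrightarrow> 0 \<le> f \<Longrightarrow> (\<And>x. min (f x) (g x) \<le> e) \<Longrightarrow> f x < 1"
proof (rule ccontr)
  assume neg: "\<not> thesis"
  have "\<exists>f :: 'a \<Rightarrow>\<^sub>C real. f \<in> J \<and> 0 \<le> f \<and> (\<exists>x. f x \<ge> 1) \<and>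
      (\<forall>x. min (f x) (g x) \<le> inverse (real (Suc n)))"
    if "g \<in> J" "0 \<le> g" for g :: "'a \<Rightarrow>\<^sub>C real" and n
  proof (rule ccontr)
    assume "\<not> ?thesis"
    then have "f x < 1"
      if "f \<in> J" "0 \<le> f" "\<And>x. min (f x) (g x) \<le> inverse (real (Suc n))"
      for f :: "'a \<Rightarrow>\<^sub>C real" and x
      using that not_less by blast
    with neg wit[OF that, of "inverse (real (Suc n))"] show False by simp
  qed
  then have "\<forall>g n. \<exists>f. g \<in> J \<longrightarrow> 0 \<le> g \<longrightarrow> f \<in> J \<and> 0 \<le> f \<and> (\<exists>x. f x \<ge> 1) \<and>
      (\<forall>x. min (f x) (g x) \<le> inverse (real (Suc n)))" by blast
  then obtain F where "\<forall>g n. g \<in> J \<longrightarrow> 0 \<le> g \<longrightarrow> F g n \<in> J \<and> 0 \<le> F g n \<and> (\<exists>x. F g n x \<ge> 1) \<and>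
      (\<forall>x. min (F g n x) (g x) \<le> inverse (real (Suc n)))"
    unfolding choice_iff by blast
  then have F: "F g n \<in> J" "0 \<le> F g n" "\<exists>x. F g n x \<ge> 1"
      "min (F g n x) (g x) \<le> inverse (real (Suc n))"
    if "g \<in> J" "0 \<le> g" for g n x
    using that by blast+
  \<comment> \<open>The tolerances are restricted to 1/(n+1), so an index is a pair (g, n). Going up
    in the product order enlarges the test function and shrinks the tolerance.\<close>
  define I where "I = {g \<in> J. 0 \<le> g} \<times> (UNIV :: nat set)"
  define le :: "('a \<Rightarrow>\<^sub>C real) \<times> nat \<Rightarrow> _ \<Rightarrow> bool"
    where "le = (\<lambda>p q. fst p \<le> fst q \<and> snd p \<le> snd q)"
  define f where "f = (\<lambda>p. F (fst p) (snd p))"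
  have sub: "subspace J" using J by (simp add: order_ideal_def)
  have dir: "directed I le"
    unfolding directed_def
  proof (intro conjI ballI impI)
    show "I \<noteq> {}" using subspace_0[OF sub] by (auto simp: I_def)
    fix p q assume "p \<in> I" "q \<in> I"
    then show "\<exists>k\<in>I. le p k \<and> le q k"
      \<comment> \<open>For positive functions the sum dominates both summands, and it stays in
        \<open>J\<close> because \<open>J\<close> is a subspace.\<close>
      by (intro bexI[of _ "(fst p + fst q, max (snd p) (snd q))"])
        (auto simp: I_def le_def subspace_add[OF sub])
  qed (auto simp: le_def intro: order_trans)
  have "un_null J I le f"
    unfolding un_null_def un_converges_def
  proof (intro ballI impI tendstoI)
    fix y and r :: real assume y: "y \<in> J" "0 \<le> y" and "r > 0"
    then obtain n where n: "inverse (real (Suc n)) < r" using reals_Archimedean by blast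
    have "norm (inf \<bar>f p - 0\<bar> y) < r" if p: "p \<in> I" "le (y, n) p" for p
    proof -
      have g: "fst p \<in> J" "0 \<le> fst p" "y \<le> fst p" "n \<le> snd p"
        using p by (auto simp: I_def le_def)
      \<comment> \<open>Since \<open>y\<close> lies below \<open>fst p\<close>, the infimum with
        \<open>y\<close> is at most the infimum with \<open>fst p\<close>, which the choice of
        \<open>F\<close> bounds by 1/(\<open>snd p\<close> + 1).\<close>
      have "norm (inf \<bar>f p - 0\<bar> y) \<le> inverse (real (Suc n))"
      proof (rule norm_bound)
        fix x
        have "0 \<le> f p x" "0 \<le> y x" "y x \<le> fst p x"
          using F(2)[OF g(1,2)] y(2) g(3) by (auto simp: f_def less_eq_bcontfun_def)
        moreover have "min (f p x) (fst p x) \<le> inverse (real (Suc (snd p)))"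
          using F(4)[OF g(1,2)] by (simp add: f_def)
        moreover have "inverse (real (Suc (snd p))) \<le> inverse (real (Suc n))"
          using g(4) by (simp add: field_simps)
        moreover from calculation have "norm (inf \<bar>f p - 0\<bar> y x) = min (f p x) (y x)"
          by (simp add: inf_real_def)
        ultimately show "norm (inf \<bar>f p - 0\<bar> y x) \<le> inverse (real (Suc n))"
          by linarith
      qed
      with n show ?thesis by simp
    qed
    then show "\<forall>\<^sub>F p in net_filter I le. dist (norm (inf \<bar>f p - 0\<bar> y)) 0 < r"
      unfolding eventually_net_filter[OF dir] using y
      by (intro bexI[of _ "(y, n)"]) (auto simp: I_def)
  qed
  moreover have "f ` I \<subseteq> J" using F(1) by (auto simp: f_def I_def)
  \<comment> \<open>The indices are pairs of a function and a natural number, not elements of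
    \<open>net_index\<close>, so the hypothesis has to be carried over to this index type
    first.\<close>
  ultimately have "un_null UNIV I le f"
    using un_null_all_nets[OF hyp dir] by blast
  \<comment> \<open>The constant 1 is a test function available in the whole space. Every
    \<open>f p\<close> reaches 1 somewhere, so its infimum with this constant has norm at least
    1.\<close>
  moreover have "0 \<le> (const_bcontfun 1 :: 'a \<Rightarrow>\<^sub>C real)"
    by (simp add: less_eq_bcontfun_def const_bcontfun.rep_eq)
  ultimately have "((\<lambda>p. norm (inf \<bar>f p\<bar> (const_bcontfun 1))) \<longlongrightarrow> 0) (net_filter I le)"
    unfolding un_null_def un_converges_def by force
  then have "\<forall>\<^sub>F p in net_filter I le. norm (inf \<bar>f p\<bar> (const_bcontfun 1)) < 1"
    by (rule order_tendstoD) simp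
  then obtain p where p: "p \<in> I" "norm (inf \<bar>f p\<bar> (const_bcontfun 1)) < 1"
    unfolding eventually_net_filter[OF dir] using dir unfolding directed_def by blast
  obtain x where "f p x \<ge> 1" using F(3)[of "fst p" "snd p"] p(1) by (auto simp: f_def I_def)
  then have "norm (inf \<bar>f p\<bar> (const_bcontfun 1) x) = 1"
    by (simp add: const_bcontfun.rep_eq inf_real_def)
  with norm_bounded[of "inf \<bar>f p\<bar> (const_bcontfun 1)" x] p(2) show False by simp
qed

lemma order_idealD:
  assumes "order_ideal J" "y \<in> J" "\<bar>x\<bar> \<le> \<bar>y\<bar>"
  shows "x \<in> J"
  using assms by (auto simp: order_ideal_def)

text \<open>By \<open>gap\<close> the set where \<open>g\<close> is nonzero equals {g \<ge> e} and
  is clopen. On it every bounded function is dominated by a multiple of \<open>g\<close>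
  (\<open>dom\<close>), and off it members of \<open>J\<close> vanish. Hence \<open>J\<close>
  consists of the functions supported on this set.\<close>

lemma projection_band_principal:
  fixes J :: "('a::topological_space \<Rightarrow>\<^sub>C real) set"
  assumes J: "order_ideal J" and g: "g \<in> J" "0 \<le> g" and e: "e > 0"
    and gap: "\<And>x. g x = 0 \<or> e \<le> g x"
    and supp: "\<And>h x. h \<in> J \<Longrightarrow> g x = 0 \<Longrightarrow> h x = 0"
  shows "projection_band J"
proof -
  have sub: "subspace J" using J by (simp add: order_ideal_def)
  have mult: "c *\<^sub>R g \<in> J" for c using sub g(1) by (rule subspace_mul)
  have dom: "\<bar>s x\<bar> \<le> (norm s / e) * g x" if "e \<le> g x" for s :: "'a \<Rightarrow>\<^sub>C real" and x
  proof -
    have "\<bar>s x\<bar> \<le> norm s" using norm_bounded[of s x] by simp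
    also have "\<dots> = (norm s / e) * e" using e by simp
    also have "\<dots> \<le> (norm s / e) * g x" using that e by (intro mult_left_mono) auto
    finally show ?thesis .
  qed
  have g0: "0 \<le> g x" for x using g(2) by (simp add: less_eq_bcontfun_def)
  have ball: "s \<in> J" if "\<And>x. \<bar>s x\<bar> \<le> c * g x" for s :: "'a \<Rightarrow>\<^sub>C real" and c
  proof (rule order_idealD[OF J mult])
    show "\<bar>s\<bar> \<le> \<bar>c *\<^sub>R g\<bar>"
      unfolding less_eq_bcontfun_def using that abs_ge_self order_trans by fastforce
  qed
  have "band J"
    unfolding band_def
  proof (intro conjI allI impI J)
    fix I :: "('a \<Rightarrow>\<^sub>C real) net_index set" and le x s
    assume *: "increasing_net I le x \<and> x ` I \<subseteq> J \<and> (\<forall>i\<in>I. 0 \<le> x i) \<and> isLub UNIV (x ` I) s"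
    then have ub: "x i \<le> s" if "i \<in> I" for i
      using that by (auto simp: isLub_def leastP_def isUb_def setle_def)
    \<comment> \<open>An index is needed to get 0 \<le> x i \<le> s; positivity of \<open>s\<close>
      later identifies it with its modulus.\<close>
    from * obtain i where "i \<in> I" by (auto simp: increasing_net_def directed_def)
    with * ub have s0: "0 \<le> s" by (meson order_trans)
    \<comment> \<open>Cutting \<open>s\<close> off at a multiple of \<open>g\<close> changes it only
      where \<open>g\<close> is zero, and there all \<open>x i\<close> are zero. So \<open>t\<close>
      is still an upper bound, and the least one, \<open>s\<close>, is dominated by that
      multiple.\<close>
    define t where "t = inf s ((norm s / e) *\<^sub>R g)"
    have "x i \<le> t" if i: "i \<in> I" for i
      unfolding less_eq_bcontfun_def
    proof
      fix z
      have le: "x i z \<le> s z" using ub[OF i] by (simp add: less_eq_bcontfun_def)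
      show "x i z \<le> t z"
        using gap[of z]
      proof
        assume z: "g z = 0"
        then have "x i z = 0" using supp * i by blast
        with z le show ?thesis by (simp add: t_def)
      next
        assume "e \<le> g z"
        from dom[OF this, of s] le show ?thesis by (simp add: t_def)
      qed
    qed
    then have "isUb UNIV (x ` I) t" by (auto simp: isUb_def setle_def)
    with * have "s \<le> t" by (auto simp: isLub_def leastP_def setge_def)
    then have "\<bar>s z\<bar> \<le> (norm s / e) * g z" for z
      using s0 by (simp add: t_def less_eq_bcontfun_def)
    then show "s \<in> J" by (rule ball)
  qed
  moreover have "J \<inter> disjoint_complement J = {0}"
  proof (intro equalityI subsetI)
    fix x assume "x \<in> J \<inter> disjoint_complement J"
    then have "inf \<bar>x\<bar> \<bar>x\<bar> = 0" unfolding disjoint_complement_def by blast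
    then show "x \<in> {0}" by simp
  next
    fix x :: "'a \<Rightarrow>\<^sub>C real" assume "x \<in> {0}"
    then show "x \<in> J \<inter> disjoint_complement J"
      using subspace_0[OF sub] by (simp add: disjoint_complement_def inf_absorb1)
  qed
  moreover have "\<exists>b\<in>J. \<exists>d\<in>disjoint_complement J. x = b + d" for x
  proof (intro bexI)
    define c where "c = norm x / e"
    \<comment> \<open>Truncating \<open>x\<close> to [-cg, cg] gives \<open>x\<close> where g \<ge>
      e and 0 where g = 0. This is \<open>x\<close> times the indicator of the clopen support, and
      continuity comes for free from the lattice operations.\<close>
    define b where "b = inf (sup x (- (c *\<^sub>R g))) (c *\<^sub>R g)"
    have c0: "0 \<le> c * g z" for z using g0[of z] e by (simp add: c_def)
    show "b \<in> J"
    proof (rule ball)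
      show "\<bar>b z\<bar> \<le> c * g z" for z
        using c0[of z] by (auto simp: b_def inf_real_def sup_real_def)
    qed
    show "x - b \<in> disjoint_complement J"
      unfolding disjoint_complement_def
    proof (intro CollectI ballI bcontfun_eqI)
      fix h z assume h: "h \<in> J"
      show "inf \<bar>x - b\<bar> \<bar>h\<bar> z = apply_bcontfun 0 z"
        using gap[of z]
      proof
        assume "g z = 0"
        with supp[OF h this] show ?thesis by (simp add: inf_real_def)
      next
        assume "e \<le> g z"
        from dom[OF this, of x] have "x z = b z"
          by (auto simp: b_def c_def inf_real_def sup_real_def)
        then show ?thesis by (simp add: inf_real_def)
      qed
    qed
    show "x = b + (x - b)" by simp
  qed
  ultimately show ?thesis by (simp add: projection_band_def)
qed

theorem theorem7p2:
  fixes J :: "('a::t2_space \<Rightarrow>\<^sub>C real) set"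
  assumes "order_ideal J" and "closed J"
    and "\<And>(I :: ('a \<Rightarrow>\<^sub>C real) net_index set) le f.
      directed I le \<Longrightarrow> f ` I \<subseteq> J \<Longrightarrow> un_null J I le f \<Longrightarrow> un_null UNIV I le f"
  shows "projection_band J"
proof -
  note J = assms(1)
  then have sub: "subspace J" by (simp add: order_ideal_def)
  obtain g e where g: "g \<in> J" "0 \<le> g" and e: "e > 0"
    and small: "\<And>f x. f \<in> J \<Longrightarrow> 0 \<le> f \<Longrightarrow> (\<And>x. min (f x) (g x) \<le> e) \<Longrightarrow> f x < 1"
    using un_null_transfer_witness[OF assms(1,3)] by blast
  have g0: "0 \<le> g x" for x using g(2) by (simp add: less_eq_bcontfun_def)
  \<comment> \<open>Vanishing wherever g > e is stable under scaling, so \<open>small\<close> keeps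
    every positive multiple of \<open>f\<close> below 1.\<close>
  have vanish: "f x = 0" if f: "f \<in> J" "0 \<le> f" "\<And>x. f x = 0 \<or> g x \<le> e" for f x
  proof (rule ccontr)
    assume "f x \<noteq> 0"
    have f0: "0 \<le> f z" for z using f(2) by (simp add: less_eq_bcontfun_def)
    \<comment> \<open>This multiple takes the value exactly 1 at \<open>x\<close>.\<close>
    define k where "k = inverse (f x)"
    have "k \<ge> 0" using f0 by (simp add: k_def)
    have "(k *\<^sub>R f) x < 1"
    proof (rule small)
      show "k *\<^sub>R f \<in> J" using sub f(1) by (rule subspace_mul)
      show "0 \<le> k *\<^sub>R f" using \<open>k \<ge> 0\<close> f(2) by (rule scaleR_nonneg_nonneg)
      show "min ((k *\<^sub>R f) z) (g z) \<le> e" for z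
        using f(3)[of z] e by (auto simp: min_le_iff_disj)
    qed
    with \<open>f x \<noteq> 0\<close> show False by (simp add: k_def)
  qed
  have gap: "g x = 0 \<or> e \<le> g x" for x
  proof -
    \<comment> \<open>This function is nonzero exactly where 0 < g < e, so its vanishing leaves no
      value of \<open>g\<close> in that interval.\<close>
    define f where "f = sup (inf g (const_bcontfun e - g)) 0"
    have f: "f z = max (min (g z) (e - g z)) 0" for z
      by (simp add: f_def const_bcontfun.rep_eq inf_real_def sup_real_def)
    have "\<bar>f\<bar> \<le> \<bar>g\<bar>" using g0 by (auto simp: less_eq_bcontfun_def f)
    with J g(1) have "f \<in> J" by (rule order_idealD)
    moreover have "0 \<le> f" by (simp add: f_def)
    moreover have "f z = 0 \<or> g z \<le> e" for z using g0[of z] by (auto simp: f)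
    ultimately have "f x = 0" by (rule vanish)
    with g0[of x] show ?thesis by (auto simp: f max_def min_def split: if_splits)
  qed
  have "h x = 0" if h: "h \<in> J" and x: "g x = 0" for h x
  proof -
    \<comment> \<open>The constant is chosen so that \<bar>h\<bar> \<le> c g wherever g \<ge> e. The
      positive part \<open>f\<close> below then lives on the zero set of \<open>g\<close>, where it
      equals \<bar>h\<bar>.\<close>
    define c where "c = norm h / e"
    have c0: "0 \<le> c" using e by (simp add: c_def)
    define f where "f = sup (\<bar>h\<bar> - c *\<^sub>R g) 0"
    have f: "f z = max (\<bar>h z\<bar> - c * g z) 0" for z by (simp add: f_def sup_real_def)
    have "\<bar>f\<bar> \<le> \<bar>h\<bar>" using g0 c0 by (auto simp: less_eq_bcontfun_def f)
    with J h have "f \<in> J" by (rule order_idealD)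
    moreover have "0 \<le> f" by (simp add: f_def)
    moreover have "f z = 0 \<or> g z \<le> e" for z
      using gap[of z]
    proof
      assume "e \<le> g z"
      have "\<bar>h z\<bar> \<le> norm h" using norm_bounded[of h z] by simp
      also have "\<dots> = c * e" using e by (simp add: c_def)
      also have "\<dots> \<le> c * g z" using \<open>e \<le> g z\<close> c0 by (rule mult_left_mono)
      finally show ?thesis by (simp add: f)
    qed (use e in simp)
    ultimately have "f x = 0" by (rule vanish)
    with x show ?thesis by (simp add: f)
  qed
  with J g e gap show ?thesis by (rule projection_band_principal)
qed

end
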